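(* Let $n\ge 1$ and let $T:\mathbb{H}^n\rightrightarrows V_1$ be a maximal H-monotone map such that $\mathrm{dom}(T)=\mathbb{H}^n$. Then $T$ is locally bounded and upper semicontinuous.
   Context: The Heisenberg group $\mathbb{H}^n$ is $\mathbb{R}^n\times\mathbb{R}^n\times\mathbb{R}$ with group law $(x,y,t)\circ(x',y',t')=(x+x',y+y',t+t'+2(\langle x',y\rangle-\langle x,y'\rangle))$ and metric $d_H(\eta,\eta')=N((\eta')^{-1}\circ\eta)$, where $N(x,y,t)=((\|x\|^2+\|y\|^2)^2+t^2)^{1/4}$ (it induces the Euclidean topology). $V_1\cong\mathbb{R}^{2n}$ is the first (horizontal) layer of its Lie algebra, with the Euclidean inner product $\langle\cdot,\cdot\rangle$ and norm, and $\xi_1:\mathbb{H}^n\to V_1$ is $\xi_1(x,y,t)=(x,y)$. For $\eta_0=(x_0,y_0,t_0)\in\mathbb{H}^n$ the horizontal plane through $\eta_0$ is $H_{\eta_0}=\{(x,y,t)\in\mathbb{H}^n: t=t_0+2(\langle y_0,x\rangle-\langle x_0,y\rangle)\}$. A set-valued map $T:\mathbb{H}^n\rightrightarrows V_1$ assigns to each $\eta$ a (possibly empty) subset $T(\eta)\subseteq V_1$; $\mathrm{dom}(T)=\{\eta: T(\eta)\ne\emptyset\}$ and $\mathrm{gr}(T)=\{(\eta,v): v\in T(\eta)\}$. A set $A\subset\mathbb{H}^n\times V_1$ is H-monotone if $\langle \xi_1(\eta)-\xi_1(\eta'),v-v'\rangle\ge 0$ for all $(\eta,v),(\eta',v')\in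 A$ with $\eta'\in H_\eta$; it is maximal H-monotone if it is H-monotone and is not properly contained in any H-monotone set. $T$ is (maximal) H-monotone if $\mathrm{gr}(T)$ is a (maximal) H-monotone set. $T$ is locally bounded if every point of $\mathbb{H}^n$ has a neighbourhood $U$ such that $T(U)=\bigcup_{\eta\in U}T(\eta)$ is bounded in $V_1$. $T$ is upper semicontinuous at $\eta$ if for every $\epsilon>0$ there is $\delta>0$ such that $T(\eta')\subseteq T(\eta)+B_{\mathbb{R}^{2n}}(0,\epsilon)$ (Minkowski sum) for all $\eta'\in\mathbb{H}^n$ with $d_H(\eta',\eta)<\delta$; $T$ is upper semicontinuous if it is so at every point. *)

theory Defs
  imports "HOL-Analysis.Analysis" "HOL-Library.Set_Algebras"
begin

text \<open>The dimension \<open>n\<close> is \<open>CARD('n)\<close>, hence at least 1. The product topology on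
  \<open>'n heis\<close> is the Euclidean one, and the library inner product and norm on
  \<open>'n horiz\<close> are the Euclidean ones of the \<open>2n\<close>-dimensional space.\<close>

type_synonym 'n heis = "(real ^ 'n) \<times> (real ^ 'n) \<times> real"
type_synonym 'n horiz = "(real ^ 'n) \<times> (real ^ 'n)"

fun heis_mult :: "'n::finite heis \<Rightarrow> 'n heis \<Rightarrow> 'n heis" where
  "heis_mult (x, y, t) (x', y', t') = (x + x', y + y', t + t' + 2 * (x' \<bullet> y - x \<bullet> y'))"

fun heis_inv :: "'n::finite heis \<Rightarrow> 'n heis" where
  "heis_inv (x, y, t) = (- x, - y, - t)"

lemma heis_mult_inv:
  "heis_mult (heis_inv \<eta>) \<eta> = 0" "heis_mult \<eta> (heis_inv \<eta>) = 0"
  "heis_mult 0 \<eta> = \<eta>" "heis_mult \<eta> 0 = \<eta>"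
  by (cases \<eta>; simp add: zero_prod_def inner_commute)+

fun heis_norm :: "'n::finite heis \<Rightarrow> real" where
  "heis_norm (x, y, t) = root 4 (((norm x)\<^sup>2 + (norm y)\<^sup>2)\<^sup>2 + t\<^sup>2)"

definition heis_dist :: "'n::finite heis \<Rightarrow> 'n heis \<Rightarrow> real" where
  "heis_dist \<eta> \<eta>' = heis_norm (heis_mult (heis_inv \<eta>') \<eta>)"

fun xi1 :: "'n::finite heis \<Rightarrow> 'n horiz" where
  "xi1 (x, y, t) = (x, y)"

fun horiz_plane :: "'n::finite heis \<Rightarrow> 'n heis set" where
  "horiz_plane (x0, y0, t0) = {(x, y, t). t = t0 + 2 * (y0 \<bullet> x - x0 \<bullet> y)}"

definition set_map_dom :: "('a \<Rightarrow> 'b set) \<Rightarrow> 'a set" where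
  "set_map_dom T = {\<eta>. T \<eta> \<noteq> {}}"

definition set_map_graph :: "('a \<Rightarrow> 'b set) \<Rightarrow> ('a \<times> 'b) set" where
  "set_map_graph T = {(\<eta>, v). v \<in> T \<eta>}"

definition H_monotone_set :: "('n::finite heis \<times> 'n horiz) set \<Rightarrow> bool" where
  "H_monotone_set A \<longleftrightarrow>
     (\<forall>(\<eta>, v) \<in> A. \<forall>(\<eta>', v') \<in> A. \<eta>' \<in> horiz_plane \<eta> \<longrightarrow> (xi1 \<eta> - xi1 \<eta>') \<bullet> (v - v') \<ge> 0)"

definition maximal_H_monotone_set :: "('n::finite heis \<times> 'n horiz) set \<Rightarrow> bool" where
  "maximal_H_monotone_set A \<longleftrightarrow>
     H_monotone_set A \<and> \<not> (\<exists>B. H_monotone_set B \<and> A \<subset> B)"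

definition maximal_H_monotone :: "('n::finite heis \<Rightarrow> 'n horiz set) \<Rightarrow> bool" where
  "maximal_H_monotone T \<longleftrightarrow> maximal_H_monotone_set (set_map_graph T)"

text \<open>Neighbourhoods are taken in the Euclidean topology, which \<open>heis_dist\<close> induces.\<close>

definition locally_bounded_map :: "('n::finite heis \<Rightarrow> 'n horiz set) \<Rightarrow> bool" where
  "locally_bounded_map T \<longleftrightarrow>
     (\<forall>\<eta>. \<exists>U. open U \<and> \<eta> \<in> U \<and> bounded (\<Union>\<eta>'\<in>U. T \<eta>'))"

text \<open>The sum of sets below is the Minkowski sum.\<close>

definition usc_at :: "('n::finite heis \<Rightarrow> 'n horiz set) \<Rightarrow> 'n heis \<Rightarrow> bool" where
  "usc_at T \<eta> \<longleftrightarrow>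
     (\<forall>\<epsilon>>0. \<exists>\<delta>>0. \<forall>\<eta>'. heis_dist \<eta>' \<eta> < \<delta> \<longrightarrow> T \<eta>' \<subseteq> T \<eta> + ball 0 \<epsilon>)"

definition usc_map :: "('n::finite heis \<Rightarrow> 'n horiz set) \<Rightarrow> bool" where
  "usc_map T \<longleftrightarrow> (\<forall>\<eta>. usc_at T \<eta>)"

end

theory Submission
  imports Defs
begin

text \<open>Local boundedness. Suppose \<open>v\<^sub>k \<in> T p\<^sub>k\<close> with \<open>p\<^sub>k \<rightarrow> \<eta>\<close>, \<open>\<bar>v\<^sub>k\<bar> \<rightarrow> \<infinity>\<close> and
  \<open>v\<^sub>k / \<bar>v\<^sub>k\<bar> \<rightarrow> w\<close>. Move from \<open>\<eta>\<close> horizontally by \<open>w\<close> to a point \<open>q\<^sub>0\<close> and fix \<open>r, r'\<close> in the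
  horizontal plane of \<open>q\<^sub>0\<close> so that \<open>q\<^sub>0\<close> is the barycentre of the triangle \<open>\<eta>, r, r'\<close>, which has
  nonzero symplectic area. The configuration is stable: near \<open>q\<^sub>0\<close> there is \<open>q\<^sub>k\<close> inside the
  projected triangle of \<open>p\<^sub>k, r, r'\<close> and lying in all three horizontal planes. Take any
  \<open>y \<in> T q\<^sub>k\<close>: in the convex combination of the three monotonicity inequalities \<open>y\<close> cancels, and
  the term with \<open>v\<^sub>k\<close>, which grows like \<open>\<bar>v\<^sub>k\<bar> / 3\<close>, is bounded above by values at the fixed
  points \<open>r, r'\<close>.

  Upper semicontinuity. By compactness it suffices that the graph is closed, and by maximality that
  a limit \<open>a\<close> of \<open>v\<^sub>k \<in> T p\<^sub>k\<close> is monotonically related to every \<open>u \<in> T \<zeta>\<close> with \<open>\<zeta>\<close> in the plane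
  of \<open>\<eta>\<close>. As \<open>\<zeta>\<close> need not lie in the plane of \<open>p\<^sub>k\<close>, compare both with a point \<open>q\<^sub>k\<close> of the two
  planes whose projection tends to the midpoint; values at \<open>q\<^sub>k\<close> stay bounded and drop out in
  the limit.\<close>

section \<open>Symplectic form and horizontal planes\<close>

text \<open>\<open>rotJ z \<bullet> w\<close> is the symplectic form in the last coordinate of the
  group law; through it, membership in a horizontal plane becomes an affine condition on the
  projection and the height.\<close>

definition rotJ :: "'a::real_inner \<times> 'a \<Rightarrow> 'a \<times> 'a" where
  "rotJ z = (snd z, - fst z)"

lemma rotJ_add: "rotJ (z + w) = rotJ z + rotJ w"
  and rotJ_diff: "rotJ (z - w) = rotJ z - rotJ w"
  and rotJ_scaleR: "rotJ (c *\<^sub>R z) = c *\<^sub>R rotJ z"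
  and rotJ_rotJ: "rotJ (rotJ z) = - z"
  by (simp_all add: rotJ_def prod_eq_iff)

lemma inner_rotJ_swap: "rotJ z \<bullet> w = - (rotJ w \<bullet> z)"
  by (simp add: rotJ_def inner_prod_def inner_commute)

lemma inner_rotJ_right: "z \<bullet> rotJ w = - (rotJ z \<bullet> w)"
  by (simp add: rotJ_def inner_prod_def)

lemma inner_rotJ_self [simp]: "rotJ z \<bullet> z = 0" "z \<bullet> rotJ z = 0"
  by (simp_all add: rotJ_def inner_prod_def inner_commute)

lemma inner_rotJ_rotJ: "rotJ z \<bullet> rotJ w = z \<bullet> w"
  by (simp add: rotJ_def inner_prod_def)

lemma tendsto_rotJ [tendsto_intros]:
  "(f \<longlongrightarrow> z) F \<Longrightarrow> ((\<lambda>k. rotJ (f k)) \<longlongrightarrow> rotJ z) F"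
  unfolding rotJ_def by (intro tendsto_intros)

definition height :: "'n::finite heis \<Rightarrow> real" where
  "height \<eta> = snd (snd \<eta>)"

definition heis_point :: "'n::finite horiz \<Rightarrow> real \<Rightarrow> 'n heis" where
  "heis_point z t = (fst z, snd z, t)"

lemma xi1_heis_point [simp]: "xi1 (heis_point z t) = z"
  and height_heis_point [simp]: "height (heis_point z t) = t"
  by (simp_all add: heis_point_def height_def)

lemma tendsto_xi1 [tendsto_intros]:
  assumes "(f \<longlongrightarrow> \<eta>) F"
  shows "((\<lambda>k. xi1 (f k)) \<longlongrightarrow> xi1 \<eta>) F"
proof -
  have eq: "xi1 \<zeta> = (fst \<zeta>, fst (snd \<zeta>))" for \<zeta> :: "'b heis"
    by (cases \<zeta>) simp
  show ?thesis
    unfolding eq by (intro tendsto_intros assms)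
qed

lemma tendsto_height [tendsto_intros]:
  "(f \<longlongrightarrow> \<eta>) F \<Longrightarrow> ((\<lambda>k. height (f k)) \<longlongrightarrow> height \<eta>) F"
  unfolding height_def by (intro tendsto_intros)

lemma tendsto_heis_point [tendsto_intros]:
  "(f \<longlongrightarrow> z) F \<Longrightarrow> (g \<longlongrightarrow> t) F \<Longrightarrow>
    ((\<lambda>k. heis_point (f k) (g k)) \<longlongrightarrow> heis_point z t) F"
  unfolding heis_point_def by (intro tendsto_intros)

lemma mem_horiz_plane_iff:
  "\<zeta> \<in> horiz_plane \<eta> \<longleftrightarrow> height \<zeta> = height \<eta> + 2 * (rotJ (xi1 \<eta>) \<bullet> xi1 \<zeta>)"
  by (cases \<eta>; cases \<zeta>) (simp add: height_def rotJ_def inner_prod_def)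

text \<open>The symplectic form is antisymmetric, so exchanging the points flips the sign of both
  the form and the height difference.\<close>

lemma horiz_plane_sym: "\<zeta> \<in> horiz_plane \<eta> \<longleftrightarrow> \<eta> \<in> horiz_plane \<zeta>"
  unfolding mem_horiz_plane_iff using inner_rotJ_swap[of "xi1 \<eta>" "xi1 \<zeta>"] by auto

text \<open>Keeping each value on its own side lets a value shared by several inequalities cancel in
  a weighted sum.\<close>

lemma H_monotone_graphD:
  assumes "H_monotone_set (set_map_graph T)" "v \<in> T \<eta>" "w \<in> T \<zeta>" "\<zeta> \<in> horiz_plane \<eta>"
  shows "(xi1 \<zeta> - xi1 \<eta>) \<bullet> v \<le> (xi1 \<zeta> - xi1 \<eta>) \<bullet> w"
proof -
  have "(\<eta>, v) \<in> set_map_graph T" "(\<zeta>, w) \<in> set_map_graph T"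
    using assms by (auto simp: set_map_graph_def)
  then have "(xi1 \<eta> - xi1 \<zeta>) \<bullet> (v - w) \<ge> 0"
    using assms(1,4) unfolding H_monotone_set_def by blast
  then show ?thesis
    by (simp add: inner_simps)
qed

section \<open>Local boundedness\<close>

text \<open>The weighted displacements from \<open>p\<close>, \<open>r\<close>, \<open>r'\<close> to
  \<open>q\<close> sum to zero, so the value \<open>y\<close> at \<open>q\<close> drops out of the
  weighted sum.\<close>

lemma H_monotone_barycentre:
  assumes mono: "H_monotone_set (set_map_graph T)"
    and T: "v \<in> T p" "b \<in> T r" "b' \<in> T r'" "y \<in> T q"
    and q: "q \<in> horiz_plane p" "q \<in> horiz_plane r" "q \<in> horiz_plane r'"
    and \<alpha>: "\<alpha> \<ge> 0" "\<beta> \<ge> 0" "\<gamma> \<ge> 0" "\<alpha> + \<beta> + \<gamma> = 1"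
    and xq: "xi1 q = \<alpha> *\<^sub>R xi1 p + \<beta> *\<^sub>R xi1 r + \<gamma> *\<^sub>R xi1 r'"
  shows "\<alpha> * ((xi1 q - xi1 p) \<bullet> v) + \<beta> * ((xi1 q - xi1 r) \<bullet> b) + \<gamma> * ((xi1 q - xi1 r') \<bullet> b') \<le> 0"
proof -
  have "\<alpha> *\<^sub>R (xi1 q - xi1 p) + \<beta> *\<^sub>R (xi1 q - xi1 r) + \<gamma> *\<^sub>R (xi1 q - xi1 r')
      = (\<alpha> + \<beta> + \<gamma>) *\<^sub>R xi1 q - (\<alpha> *\<^sub>R xi1 p + \<beta> *\<^sub>R xi1 r + \<gamma> *\<^sub>R xi1 r')"
    by (simp add: algebra_simps)
  also have "\<dots> = 0"
    using \<alpha>(4) xq by simp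
  finally have "(\<alpha> *\<^sub>R (xi1 q - xi1 p) + \<beta> *\<^sub>R (xi1 q - xi1 r) + \<gamma> *\<^sub>R (xi1 q - xi1 r')) \<bullet> y = 0"
    by simp
  then have "\<alpha> * ((xi1 q - xi1 p) \<bullet> y) + \<beta> * ((xi1 q - xi1 r) \<bullet> y) + \<gamma> * ((xi1 q - xi1 r') \<bullet> y) = 0"
    by (simp only: inner_add_left inner_scaleR_left)
  moreover have "\<alpha> * ((xi1 q - xi1 p) \<bullet> v) \<le> \<alpha> * ((xi1 q - xi1 p) \<bullet> y)"
    "\<beta> * ((xi1 q - xi1 r) \<bullet> b) \<le> \<beta> * ((xi1 q - xi1 r) \<bullet> y)"
    "\<gamma> * ((xi1 q - xi1 r') \<bullet> b') \<le> \<gamma> * ((xi1 q - xi1 r') \<bullet> y)"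
    by (intro mult_left_mono H_monotone_graphD[OF mono _ T(4)] T q \<alpha>)+
  ultimately show ?thesis by linarith
qed

text \<open>The weights solve the linear system saying that \<open>q\<close> lies in the three planes; \<open>S\<close> is
  the symplectic area of the projected triangle.\<close>

lemma barycentre_in_horiz_planes:
  fixes p r r' :: "'n::finite heis"
  defines "A \<equiv> rotJ (xi1 p) \<bullet> xi1 r" and "B \<equiv> rotJ (xi1 r) \<bullet> xi1 r'"
    and "C \<equiv> rotJ (xi1 r') \<bullet> xi1 p"
  defines "S \<equiv> A + B + C"
  assumes S: "S \<noteq> 0"
    and \<alpha>: "\<alpha> = (B + (height r - height r') / 2) / S"
    and \<beta>: "\<beta> = (C + (height r' - height p) / 2) / S"
    and \<gamma>: "\<gamma> = (A + (height p - height r) / 2) / S"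
    and z: "z = \<alpha> *\<^sub>R xi1 p + \<beta> *\<^sub>R xi1 r + \<gamma> *\<^sub>R xi1 r'"
    and q: "q = heis_point z (height p + 2 * (rotJ (xi1 p) \<bullet> z))"
  shows "\<alpha> + \<beta> + \<gamma> = 1" "q \<in> horiz_plane p" "q \<in> horiz_plane r" "q \<in> horiz_plane r'"
proof -
  have *: "S * \<alpha> = B + (height r - height r') / 2" "S * \<beta> = C + (height r' - height p) / 2"
    "S * \<gamma> = A + (height p - height r) / 2"
    using S \<alpha> \<beta> \<gamma> by simp_all
  have "S * (\<alpha> + \<beta> + \<gamma>) = S"
    unfolding distrib_left * by (simp add: S_def field_simps)
  then show sum: "\<alpha> + \<beta> + \<gamma> = 1" using S by simp
  \<comment> \<open>The form vanishes on equal arguments, so each vertex pairs only with the other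
    two.\<close>
  have zp: "rotJ (xi1 p) \<bullet> z = \<beta> * A - \<gamma> * C"
    unfolding z A_def C_def using inner_rotJ_swap[of "xi1 p" "xi1 r'"] by (simp add: inner_simps)
  have zr: "rotJ (xi1 r) \<bullet> z = \<gamma> * B - \<alpha> * A"
    unfolding z A_def B_def using inner_rotJ_swap[of "xi1 r" "xi1 p"] by (simp add: inner_simps)
  have zr': "rotJ (xi1 r') \<bullet> z = \<alpha> * C - \<beta> * B"
    unfolding z C_def B_def using inner_rotJ_swap[of "xi1 r'" "xi1 r"] by (simp add: inner_simps)
  show "q \<in> horiz_plane p"
    by (simp add: mem_horiz_plane_iff q)
  \<comment> \<open>The planes of \<open>p\<close> and \<open>r\<close> have equal height over
    \<open>z\<close> exactly when this difference is \<open>(height r - height p) / 2\<close>; the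
    value of \<open>\<gamma>\<close> was solved from that.\<close>
  have "\<beta> * A - \<gamma> * C - (\<gamma> * B - \<alpha> * A) = (\<alpha> + \<beta> + \<gamma>) * A - S * \<gamma>"
    by (simp add: S_def algebra_simps)
  then have "\<beta> * A - \<gamma> * C - (\<gamma> * B - \<alpha> * A) = (height r - height p) / 2"
    unfolding sum * by (simp add: field_simps)
  then show "q \<in> horiz_plane r"
    by (simp add: mem_horiz_plane_iff q zp zr field_simps)
  have "\<beta> * A - \<gamma> * C - (\<alpha> * C - \<beta> * B) = S * \<beta> - (\<alpha> + \<beta> + \<gamma>) * C"
    by (simp add: S_def algebra_simps)
  then have "\<beta> * A - \<gamma> * C - (\<alpha> * C - \<beta> * B) = (height r' - height p) / 2"
    unfolding sum * by (simp add: field_simps)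
  then show "q \<in> horiz_plane r'"
    by (simp add: mem_horiz_plane_iff q zp zr' field_simps)
qed

lemma H_monotone_no_blowup:
  fixes T :: "'n::finite heis \<Rightarrow> 'n horiz set"
  assumes mono: "H_monotone_set (set_map_graph T)" and dom: "\<And>\<eta>. T \<eta> \<noteq> {}"
    and p: "p \<longlonglongrightarrow> \<eta>" and v: "\<And>k. v k \<in> T (p k)"
    and inf: "filterlim (\<lambda>k. norm (v k)) at_top sequentially"
    and w: "(\<lambda>k. v k /\<^sub>R norm (v k)) \<longlonglongrightarrow> w"
  shows False
proof -
  have "(\<lambda>k. norm (v k /\<^sub>R norm (v k))) \<longlonglongrightarrow> norm w"
    by (intro tendsto_intros w)
  moreover have "eventually (\<lambda>k. norm (v k) > 0) sequentially"
    using inf unfolding filterlim_at_top_dense by blast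
  then have "eventually (\<lambda>k. norm (v k /\<^sub>R norm (v k)) = 1) sequentially"
    by eventually_elim simp
  ultimately have "norm w = 1"
    by (rule LIMSEQ_unique[OF _ tendsto_eventually])
  then have ww: "w \<bullet> w = 1" by (simp add: norm_eq_1)
  \<comment> \<open>The projections of \<open>\<eta>\<close>, \<open>r\<close>, \<open>r'\<close>
    average to \<open>xi1 \<eta> + w\<close>; the offsets by \<open>rotJ w\<close> in opposite
    directions keep the triangle nondegenerate. The heights put \<open>q0\<close> in the plane of
    \<open>\<eta>\<close>, and \<open>r\<close>, \<open>r'\<close> in the plane of
    \<open>q0\<close>.\<close>
  define zr where "zr = xi1 \<eta> + (3/2) *\<^sub>R w + rotJ w"
  define zr' where "zr' = xi1 \<eta> + (3/2) *\<^sub>R w - rotJ w"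
  define q0 where "q0 = heis_point (xi1 \<eta> + w) (height \<eta> + 2 * (rotJ (xi1 \<eta>) \<bullet> w))"
  define r where "r = heis_point zr (height q0 + 2 * (rotJ (xi1 q0) \<bullet> zr))"
  define r' where "r' = heis_point zr' (height q0 + 2 * (rotJ (xi1 q0) \<bullet> zr'))"
  \<comment> \<open>The data of the barycentre are functions of the moving vertex alone, with
    \<open>r\<close> and \<open>r'\<close> fixed; continuity at \<open>\<eta>\<close> then gives
    their limits along \<open>p k\<close>.\<close>
  define A where "A p = rotJ (xi1 p) \<bullet> xi1 r" for p
  define B where "B = rotJ (xi1 r) \<bullet> xi1 r'"
  define C where "C p = rotJ (xi1 r') \<bullet> xi1 p" for p
  define S where "S p = A p + B + C p" for p
  define \<alpha> where "\<alpha> p = (B + (height r - height r') / 2) / S p" for p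
  define \<beta> where "\<beta> p = (C p + (height r' - height p) / 2) / S p" for p
  define \<gamma> where "\<gamma> p = (A p + (height p - height r) / 2) / S p" for p
  define z where "z p = \<alpha> p *\<^sub>R xi1 p + \<beta> p *\<^sub>R xi1 r + \<gamma> p *\<^sub>R xi1 r'" for p
  define q where "q p = heis_point (z p) (height p + 2 * (rotJ (xi1 p) \<bullet> z p))" for p
  have sw: "rotJ w \<bullet> xi1 \<eta> = - (rotJ (xi1 \<eta>) \<bullet> w)" by (rule inner_rotJ_swap)
  note ev = zr_def zr'_def q0_def r_def r'_def A_def B_def C_def
    rotJ_add rotJ_diff rotJ_scaleR rotJ_rotJ inner_rotJ_rotJ inner_simps ww sw
    inner_rotJ_right inner_commute[of w "xi1 \<eta>"]
  have S\<eta>: "S \<eta> = - 3" unfolding S_def by (simp add: ev field_simps)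
  have \<alpha>\<eta>: "\<alpha> \<eta> = 1/3" unfolding \<alpha>_def S\<eta> by (simp add: ev field_simps)
  have \<beta>\<eta>: "\<beta> \<eta> = 1/3" unfolding \<beta>_def S\<eta> by (simp add: ev field_simps)
  have \<gamma>\<eta>: "\<gamma> \<eta> = 1/3" unfolding \<gamma>_def S\<eta> by (simp add: ev field_simps)
  have z\<eta>: "z \<eta> = xi1 \<eta> + w"
    unfolding z_def \<alpha>\<eta> \<beta>\<eta> \<gamma>\<eta> r_def r'_def xi1_heis_point zr_def zr'_def
    by (simp add: prod_eq_iff vec_eq_iff field_simps)
  have limS: "(\<lambda>k. S (p k)) \<longlonglongrightarrow> - 3"
    unfolding S\<eta>[symmetric] unfolding S_def A_def C_def by (intro tendsto_intros p)
  have lim\<alpha>: "(\<lambda>k. \<alpha> (p k)) \<longlonglongrightarrow> 1/3"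
    unfolding \<alpha>\<eta>[symmetric] unfolding \<alpha>_def by (rule tendsto_eq_intros limS refl | simp add: S\<eta>)+
  have lim\<beta>: "(\<lambda>k. \<beta> (p k)) \<longlonglongrightarrow> 1/3"
    unfolding \<beta>\<eta>[symmetric] unfolding \<beta>_def S\<eta> C_def by (intro tendsto_intros limS p) simp_all
  have lim\<gamma>: "(\<lambda>k. \<gamma> (p k)) \<longlonglongrightarrow> 1/3"
    unfolding \<gamma>\<eta>[symmetric] unfolding \<gamma>_def S\<eta> A_def by (intro tendsto_intros limS p) simp_all
  have limz: "(\<lambda>k. z (p k)) \<longlonglongrightarrow> xi1 \<eta> + w"
    unfolding z\<eta>[symmetric] unfolding z_def \<alpha>\<eta> \<beta>\<eta> \<gamma>\<eta> by (intro tendsto_intros lim\<alpha> lim\<beta> lim\<gamma> p)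
  obtain b b' where b: "b \<in> T r" "b' \<in> T r'" using dom by blast
  \<comment> \<open>\<open>D\<close> collects the terms at the fixed points \<open>r\<close>,
    \<open>r'\<close>; \<open>E\<close> is the left side of the barycentre inequality divided by
    \<open>norm (v k)\<close>.\<close>
  define D where "D k = \<beta> (p k) * ((z (p k) - xi1 r) \<bullet> b) + \<gamma> (p k) * ((z (p k) - xi1 r') \<bullet> b')" for k
  define E where "E k = \<alpha> (p k) * ((z (p k) - xi1 (p k)) \<bullet> (v k /\<^sub>R norm (v k))) + D k / norm (v k)" for k
  \<comment> \<open>The limits \<open>- 3\<close> and \<open>1/3\<close> are nonzero, so the
    triangle stays nondegenerate and the weights stay positive for large \<open>k\<close>.\<close>
  have "eventually (\<lambda>k. S (p k) < 0) sequentially" "eventually (\<lambda>k. \<alpha> (p k) > 0) sequentially"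
    "eventually (\<lambda>k. \<beta> (p k) > 0) sequentially" "eventually (\<lambda>k. \<gamma> (p k) > 0) sequentially"
    using order_tendstoD limS lim\<alpha> lim\<beta> lim\<gamma> by (force intro: order_tendstoD)+
  then have le: "eventually (\<lambda>k. E k \<le> 0) sequentially"
    using \<open>eventually (\<lambda>k. norm (v k) > 0) sequentially\<close>
  proof eventually_elim
    case (elim k)
    obtain y where y: "y \<in> T (q (p k))" using dom by blast
    have S0: "S (p k) \<noteq> 0" using elim by simp
    note bary = barycentre_in_horiz_planes[OF
        S0[unfolded S_def A_def B_def C_def]
        \<alpha>_def[of "p k", unfolded S_def A_def B_def C_def] \<beta>_def[of "p k", unfolded S_def A_def B_def C_def]
        \<gamma>_def[of "p k", unfolded S_def A_def B_def C_def] z_def q_def]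
    have "xi1 (q (p k)) = z (p k)" by (simp add: q_def)
    then have "\<alpha> (p k) * ((z (p k) - xi1 (p k)) \<bullet> v k) + D k \<le> 0"
      using H_monotone_barycentre[OF mono v[of k] b y bary(2-4) _ _ _ bary(1)] elim
      unfolding D_def by (simp add: z_def)
    moreover have "E k = (\<alpha> (p k) * ((z (p k) - xi1 (p k)) \<bullet> v k) + D k) / norm (v k)"
      unfolding E_def using elim by (simp add: field_simps)
    ultimately show ?case
      by (simp add: divide_nonpos_nonneg)
  qed
  have limD: "D \<longlonglongrightarrow> 1/3 * ((xi1 \<eta> + w - xi1 r) \<bullet> b) + 1/3 * ((xi1 \<eta> + w - xi1 r') \<bullet> b')"
    unfolding D_def by (intro tendsto_intros limz lim\<beta> lim\<gamma>)
  \<comment> \<open>Normalisation removes the fixed points; the remaining term tends to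
    \<open>1/3 * (w \<bullet> w)\<close>.\<close>
  have "(\<lambda>k. D k / norm (v k)) \<longlonglongrightarrow> 0"
    using limD inf by (rule real_tendsto_divide_at_top)
  then have "E \<longlonglongrightarrow> 1/3 * ((xi1 \<eta> + w - xi1 \<eta>) \<bullet> w) + 0"
    unfolding E_def by (intro tendsto_intros limz lim\<alpha> p w)
  then have "E \<longlonglongrightarrow> 1/3" using ww by simp
  then have "1/3 \<le> (0::real)"
    using le by (intro tendsto_upperbound[of E]) auto
  then show False by simp
qed

text \<open>Unboundedness at every scale yields values with norms tending to infinity, and
  compactness of the unit ball of \<open>V_1\<close> gives a limiting direction, as ruled out by
  \<open>H_monotone_no_blowup\<close>.\<close>

lemma H_monotone_locally_bounded:
  fixes T :: "'n::finite heis \<Rightarrow> 'n horiz set"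
  assumes mono: "H_monotone_set (set_map_graph T)" and dom: "\<And>\<eta>. T \<eta> \<noteq> {}"
  shows "locally_bounded_map T"
  unfolding locally_bounded_map_def
proof (rule allI, rule ccontr)
  fix \<eta> :: "'n heis"
  assume neg: "\<nexists>U. open U \<and> \<eta> \<in> U \<and> bounded (\<Union>\<zeta>\<in>U. T \<zeta>)"
  have "\<exists>\<zeta> u. dist \<zeta> \<eta> < inverse (real (Suc k)) \<and> u \<in> T \<zeta> \<and> norm u > real k" for k
  proof (rule ccontr)
    assume "\<not> ?thesis"
    then have "bounded (\<Union>\<zeta>\<in>ball \<eta> (inverse (real (Suc k))). T \<zeta>)"
      unfolding bounded_iff by (force simp: dist_commute not_less)
    then show False
      using neg by (metis centre_in_ball inverse_positive_iff_positive of_nat_0_less_iff open_ball zero_less_Suc)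
  qed
  then obtain p v where p: "\<And>k. dist (p k) \<eta> < inverse (real (Suc k))" and v: "\<And>k. v k \<in> T (p k)"
    and nv: "\<And>k. norm (v k) > real k"
    by metis
  have limp: "p \<longlonglongrightarrow> \<eta>"
  proof (rule tendsto_dist_iff[THEN iffD2], rule Lim_null_comparison)
    show "eventually (\<lambda>k. norm (dist (p k) \<eta>) \<le> inverse (real (Suc k))) sequentially"
      by (intro always_eventually allI) (simp only: real_norm_def abs_of_nonneg zero_le_dist less_imp_le[OF p])
    show "(\<lambda>k. inverse (real (Suc k))) \<longlonglongrightarrow> 0"
      by (rule LIMSEQ_inverse_real_of_nat)
  qed
  have inf: "filterlim (\<lambda>k. norm (v k)) at_top sequentially"
    by (rule filterlim_at_top_mono[OF filterlim_real_sequentially])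
      (auto intro!: always_eventually less_imp_le[OF nv])
  have "bounded (range (\<lambda>k. v k /\<^sub>R norm (v k)))"
    unfolding bounded_iff by (intro exI[of _ 1]) (auto simp: divide_simps)
  then obtain w s where s: "strict_mono (s :: nat \<Rightarrow> nat)"
    and w: "((\<lambda>k. v k /\<^sub>R norm (v k)) \<circ> s) \<longlonglongrightarrow> w"
    using bounded_imp_convergent_subsequence by blast
  show False
  proof (rule H_monotone_no_blowup[OF mono dom])
    show "(p \<circ> s) \<longlonglongrightarrow> \<eta>" by (rule LIMSEQ_subseq_LIMSEQ[OF limp s])
    show "(v \<circ> s) k \<in> T ((p \<circ> s) k)" for k using v by simp
    show "filterlim (\<lambda>k. norm ((v \<circ> s) k)) at_top sequentially"
      using filterlim_compose[OF inf filterlim_subseq[OF s]] by simp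
    show "(\<lambda>k. (v \<circ> s) k /\<^sub>R norm ((v \<circ> s) k)) \<longlonglongrightarrow> w"
      using w by (simp add: o_def)
  qed
qed

section \<open>Closedness of the graph\<close>

text \<open>Inserting \<open>(\<eta>, v)\<close> keeps the graph H-monotone, so maximality forces
  the pair to be there already. Symmetry of the planes covers the reversed order of points.\<close>

lemma maximal_H_monotone_memI:
  assumes max: "maximal_H_monotone T"
    and rel: "\<And>\<zeta> u. \<zeta> \<in> horiz_plane \<eta> \<Longrightarrow> u \<in> T \<zeta> \<Longrightarrow> (xi1 \<eta> - xi1 \<zeta>) \<bullet> (v - u) \<ge> 0"
  shows "v \<in> T \<eta>"
proof (rule ccontr)
  assume "v \<notin> T \<eta>"
  have mono: "H_monotone_set (set_map_graph T)"
    using max by (simp add: maximal_H_monotone_def maximal_H_monotone_set_def)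
  have rel': "(xi1 \<zeta> - xi1 \<eta>) \<bullet> (u - v) \<ge> 0" if "\<eta> \<in> horiz_plane \<zeta>" "u \<in> T \<zeta>" for \<zeta> u
    using rel[of \<zeta> u] that horiz_plane_sym[of \<eta> \<zeta>] by (simp add: inner_simps)
  have "H_monotone_set (insert (\<eta>, v) (set_map_graph T))"
    using mono rel rel' unfolding H_monotone_set_def set_map_graph_def by auto
  moreover have "set_map_graph T \<subset> insert (\<eta>, v) (set_map_graph T)"
    using \<open>v \<notin> T \<eta>\<close> by (auto simp: set_map_graph_def)
  ultimately show False
    using max by (auto simp: maximal_H_monotone_def maximal_H_monotone_set_def)
qed

lemma maximal_H_monotone_closed_graph:
  fixes T :: "'n::finite heis \<Rightarrow> 'n horiz set"
  assumes max: "maximal_H_monotone T" and dom: "\<And>\<eta>. T \<eta> \<noteq> {}"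
    and p: "p \<longlonglongrightarrow> \<eta>" and v: "\<And>k. v k \<in> T (p k)" and limv: "v \<longlonglongrightarrow> a"
  shows "a \<in> T \<eta>"
proof (rule maximal_H_monotone_memI[OF max])
  fix \<zeta> u
  assume \<zeta>: "\<zeta> \<in> horiz_plane \<eta>" and u: "u \<in> T \<zeta>"
  have mono: "H_monotone_set (set_map_graph T)"
    using max by (simp add: maximal_H_monotone_def maximal_H_monotone_set_def)
  show "(xi1 \<eta> - xi1 \<zeta>) \<bullet> (a - u) \<ge> 0"
  proof (cases "xi1 \<eta> = xi1 \<zeta>")
    case False
    define d where "d k = xi1 (p k) - xi1 \<zeta>" for k
    define d0 where "d0 = xi1 \<eta> - xi1 \<zeta>"
    \<comment> \<open>Over \<open>z k\<close> the planes of \<open>p k\<close> and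
      \<open>\<zeta>\<close> agree when \<open>rotJ (d k) \<bullet> z k\<close> is half their height
      difference. Moving the midpoint by \<open>c k\<close> along \<open>rotJ (d k)\<close> adds
      \<open>c k * (d k \<bullet> d k)\<close>, which fixes \<open>c k\<close>.\<close>
    define c where "c k = ((height \<zeta> - height (p k)) / 2 - rotJ (xi1 (p k)) \<bullet> xi1 \<zeta>) / (d k \<bullet> d k)" for k
    define z where "z k = (xi1 (p k) + xi1 \<zeta>) /\<^sub>R 2 + c k *\<^sub>R rotJ (d k)" for k
    define q where "q k = heis_point (z k) (height \<zeta> + 2 * (rotJ (xi1 \<zeta>) \<bullet> z k))" for k
    have limd: "d \<longlonglongrightarrow> d0" unfolding d_def d0_def by (intro tendsto_intros p)
    have d0: "d0 \<bullet> d0 > 0" using False by (simp add: d0_def)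
    have "c \<longlonglongrightarrow> ((height \<zeta> - height \<eta>) / 2 - rotJ (xi1 \<eta>) \<bullet> xi1 \<zeta>) / (d0 \<bullet> d0)"
      unfolding c_def using d0 by (intro tendsto_intros limd p) auto
    \<comment> \<open>The numerator vanishes in the limit because \<open>\<zeta>\<close> lies in the
      plane of \<open>\<eta>\<close>.\<close>
    then have limc: "c \<longlonglongrightarrow> 0"
      using \<zeta> by (simp add: mem_horiz_plane_iff)
    have limz: "z \<longlonglongrightarrow> (xi1 \<eta> + xi1 \<zeta>) /\<^sub>R 2 + 0 *\<^sub>R rotJ d0"
      unfolding z_def by (intro tendsto_intros limd p limc)
    from tendsto_heis_point[OF this tendsto_add[OF tendsto_const tendsto_mult[OF tendsto_const
            tendsto_inner[OF tendsto_const this]]]]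
    obtain q0 where limq: "q \<longlonglongrightarrow> q0"
      unfolding q_def by blast
    define y where "y k = (SOME u. u \<in> T (q k))" for k
    have y: "y k \<in> T (q k)" for k unfolding y_def by (rule some_in_eq[THEN iffD2, OF dom])
    obtain U where U: "open U" "q0 \<in> U" "bounded (\<Union>\<eta>\<in>U. T \<eta>)"
      using H_monotone_locally_bounded[OF mono dom] unfolding locally_bounded_map_def by blast
    then obtain M where M: "\<And>x u. x \<in> U \<Longrightarrow> u \<in> T x \<Longrightarrow> norm u \<le> M"
      unfolding bounded_iff by blast
    have "eventually (\<lambda>k. q k \<in> U) sequentially"
      using limq U topological_tendstoD by blast
    then have bd: "eventually (\<lambda>k. norm (y k) \<le> M) sequentially"
      by eventually_elim (use M y in blast)
    \<comment> \<open>\<open>e k\<close> is the sum of the displacements from \<open>p k\<close> and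
      \<open>\<zeta>\<close> to \<open>q k\<close>: the midpoint part cancels and only the vanishing
      correction multiplies \<open>y k\<close>.\<close>
    define e where "e k = (2 * c k) *\<^sub>R rotJ (d k)" for k
    have "e \<longlonglongrightarrow> (2 * 0) *\<^sub>R rotJ d0"
      unfolding e_def by (intro tendsto_intros limd limc)
    then have lime: "e \<longlonglongrightarrow> 0" by simp
    have limey: "(\<lambda>k. e k \<bullet> y k) \<longlonglongrightarrow> 0"
    proof (rule Lim_null_comparison)
      show "eventually (\<lambda>k. norm (e k \<bullet> y k) \<le> norm (e k) * M) sequentially"
        using bd by eventually_elim
          (metis Cauchy_Schwarz_ineq2 mult_left_mono norm_ge_zero order_trans real_norm_def)
      show "(\<lambda>k. norm (e k) * M) \<longlonglongrightarrow> 0"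
        using tendsto_mult[OF tendsto_norm[OF lime] tendsto_const[of M]] by simp
    qed
    have "eventually (\<lambda>k. d k \<bullet> d k > 0) sequentially"
      using limd d0 by (intro order_tendstoD(1)[of _ "d0 \<bullet> d0"] tendsto_intros)
    then have le: "eventually (\<lambda>k. (z k - xi1 (p k)) \<bullet> v k + (z k - xi1 \<zeta>) \<bullet> u \<le> e k \<bullet> y k) sequentially"
    proof eventually_elim
      case (elim k)
      have q\<zeta>: "q k \<in> horiz_plane \<zeta>" by (simp add: mem_horiz_plane_iff q_def)
      have "rotJ (d k) \<bullet> z k = rotJ (xi1 (p k)) \<bullet> xi1 \<zeta> + c k * (d k \<bullet> d k)"
        using inner_rotJ_swap[of "xi1 \<zeta>" "xi1 (p k)"]
        by (simp add: z_def inner_simps inner_rotJ_rotJ)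
          (simp add: d_def rotJ_diff inner_simps)
      also have "\<dots> = (height \<zeta> - height (p k)) / 2"
        using elim by (simp add: c_def)
      finally have "rotJ (xi1 (p k)) \<bullet> z k - rotJ (xi1 \<zeta>) \<bullet> z k = (height \<zeta> - height (p k)) / 2"
        by (simp add: d_def rotJ_diff inner_simps)
      then have qp: "q k \<in> horiz_plane (p k)"
        by (simp add: mem_horiz_plane_iff q_def field_simps)
      have "(z k - xi1 (p k)) \<bullet> v k + (z k - xi1 \<zeta>) \<bullet> u
          \<le> (z k - xi1 (p k)) \<bullet> y k + (z k - xi1 \<zeta>) \<bullet> y k"
        using H_monotone_graphD[OF mono v y qp] H_monotone_graphD[OF mono u y q\<zeta>]
        by (simp add: q_def)
      also have "\<dots> = e k \<bullet> y k"
        by (simp add: e_def z_def inner_simps)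
      finally show ?case .
    qed
    \<comment> \<open>At the midpoint the two displacements are opposite halves of
      \<open>xi1 \<eta> - xi1 \<zeta>\<close>, so the limit inequality is half of the claim.\<close>
    define z0 where "z0 = (xi1 \<eta> + xi1 \<zeta>) /\<^sub>R 2"
    have "(\<lambda>k. (z k - xi1 (p k)) \<bullet> v k + (z k - xi1 \<zeta>) \<bullet> u)
        \<longlonglongrightarrow> (z0 - xi1 \<eta>) \<bullet> a + (z0 - xi1 \<zeta>) \<bullet> u"
      using limz unfolding z0_def[symmetric] by (intro tendsto_intros p limv) simp_all
    from tendsto_le[OF _ limey this le]
    have "(z0 - xi1 \<eta>) \<bullet> a + (z0 - xi1 \<zeta>) \<bullet> u \<le> 0" by simp
    then show ?thesis
      by (simp add: z0_def inner_simps field_simps)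
  qed simp
qed

section \<open>Convergence in the Heisenberg distance\<close>

text \<open>The vertical coordinate has homogeneous degree two, hence the square in its
  bound.\<close>

lemma heis_norm_bounds:
  "norm x \<le> heis_norm (x, y, t)" "norm y \<le> heis_norm (x, y, t)" "\<bar>t\<bar> \<le> (heis_norm (x, y, t))\<^sup>2"
proof -
  let ?N = "heis_norm (x, y, t)"
  let ?r = "(norm x)\<^sup>2 + (norm y)\<^sup>2"
  have N0: "0 \<le> ?N" by simp
  have "?N ^ 4 = ?r\<^sup>2 + t\<^sup>2" by (simp add: real_root_pow_pos2)
  then have "(?N\<^sup>2)\<^sup>2 = ?r\<^sup>2 + t\<^sup>2" by (simp add: power_mult[symmetric])
  then have "?r\<^sup>2 \<le> (?N\<^sup>2)\<^sup>2" "\<bar>t\<bar>\<^sup>2 \<le> (?N\<^sup>2)\<^sup>2" by simp_all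
  then have "?r \<le> ?N\<^sup>2" and t: "\<bar>t\<bar> \<le> ?N\<^sup>2"
    by (meson power2_le_imp_le zero_le_power2)+
  then have "(norm x)\<^sup>2 \<le> ?N\<^sup>2" "(norm y)\<^sup>2 \<le> ?N\<^sup>2"
    by (smt (verit) zero_le_power2)+
  then show "norm x \<le> ?N" "norm y \<le> ?N" using N0 by (meson power2_le_imp_le)+
  show "\<bar>t\<bar> \<le> ?N\<^sup>2" by (rule t)
qed

lemma heis_dist_tendsto_imp_tendsto:
  fixes p :: "nat \<Rightarrow> 'n::finite heis"
  assumes "(\<lambda>k. heis_dist (p k) \<eta>) \<longlonglongrightarrow> 0"
  shows "p \<longlonglongrightarrow> \<eta>"
proof -
  obtain x0 y0 t0 where \<eta>: "\<eta> = (x0, y0, t0)" by (cases \<eta>)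
  define x where "x k = fst (p k)" for k
  define y where "y k = fst (snd (p k))" for k
  define t where "t k = snd (snd (p k))" for k
  \<comment> \<open>The last coordinate of \<open>heis_mult (heis_inv \<eta>) (p k)\<close>. Its
    bilinear term vanishes once \<open>x\<close> and \<open>y\<close> converge, which recovers the
    limit of \<open>t\<close>.\<close>
  define s where "s k = t k - t0 + 2 * (x0 \<bullet> y k - x k \<bullet> y0)" for k
  have p: "p = (\<lambda>k. (x k, y k, t k))" by (simp add: x_def y_def t_def)
  have dist: "heis_dist (p k) \<eta> = heis_norm (x k - x0, y k - y0, s k)" for k
    by (simp add: p \<eta> heis_dist_def s_def algebra_simps del: heis_norm.simps)
  have 0: "(\<lambda>k. heis_norm (x k - x0, y k - y0, s k)) \<longlonglongrightarrow> 0"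
    using assms unfolding dist .
  have "(\<lambda>k. x k - x0) \<longlonglongrightarrow> 0" "(\<lambda>k. y k - y0) \<longlonglongrightarrow> 0"
    by (rule Lim_null_comparison[OF always_eventually 0], use heis_norm_bounds in blast)+
  then have x: "x \<longlonglongrightarrow> x0" and y: "y \<longlonglongrightarrow> y0" by (simp_all add: LIM_zero_iff)
  have "(\<lambda>k. (heis_norm (x k - x0, y k - y0, s k))\<^sup>2) \<longlonglongrightarrow> 0"
    using tendsto_power[OF 0, of 2] by simp
  then have "s \<longlonglongrightarrow> 0"
    by (rule Lim_null_comparison[OF always_eventually, rotated]) (use heis_norm_bounds in auto)
  then have "(\<lambda>k. s k + t0 - 2 * (x0 \<bullet> y k - x k \<bullet> y0)) \<longlonglongrightarrow> 0 + t0 - 2 * (x0 \<bullet> y0 - x0 \<bullet> y0)"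
    by (intro tendsto_intros x y)
  then have "t \<longlonglongrightarrow> t0" by (simp add: s_def)
  then show ?thesis unfolding p \<eta> by (intro tendsto_intros x y)
qed

section \<open>Upper semicontinuity by compactness\<close>

theorem corollary3p1:
  fixes T :: "'n::finite heis \<Rightarrow> 'n horiz set"
  assumes "maximal_H_monotone T"
    and "set_map_dom T = UNIV"
  shows "locally_bounded_map T \<and> usc_map T"
proof
  have mono: "H_monotone_set (set_map_graph T)"
    using assms(1) by (simp add: maximal_H_monotone_def maximal_H_monotone_set_def)
  have dom: "\<And>\<eta>. T \<eta> \<noteq> {}" using assms(2) by (auto simp: set_map_dom_def)
  show lb: "locally_bounded_map T" by (rule H_monotone_locally_bounded[OF mono dom])
  show "usc_map T"
    unfolding usc_map_def usc_at_def
  proof (intro allI impI, rule ccontr)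
    fix \<eta> :: "'n heis" and \<epsilon> :: real
    assume \<epsilon>: "\<epsilon> > 0"
      and neg: "\<not> (\<exists>\<delta>>0. \<forall>\<eta>'. heis_dist \<eta>' \<eta> < \<delta> \<longrightarrow> T \<eta>' \<subseteq> T \<eta> + ball 0 \<epsilon>)"
    have "\<exists>\<zeta> u. heis_dist \<zeta> \<eta> < inverse (real (Suc k)) \<and> u \<in> T \<zeta> \<and> u \<notin> T \<eta> + ball 0 \<epsilon>" for k
      using neg by (meson inverse_positive_iff_positive of_nat_0_less_iff subsetI zero_less_Suc)
    then obtain p v where p: "\<And>k. heis_dist (p k) \<eta> < inverse (real (Suc k))"
      and v: "\<And>k. v k \<in> T (p k)" and far: "\<And>k. v k \<notin> T \<eta> + ball 0 \<epsilon>"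
      by metis
    have "0 \<le> heis_dist \<zeta> \<eta>" for \<zeta>
      unfolding heis_dist_def by (cases "heis_mult (heis_inv \<eta>) \<zeta>") simp
    then have limp: "p \<longlonglongrightarrow> \<eta>"
      by (intro heis_dist_tendsto_imp_tendsto
          tendsto_sandwich[OF _ _ tendsto_const LIMSEQ_inverse_real_of_nat])
        (auto intro!: always_eventually less_imp_le[OF p] simp del: of_nat_Suc)
    obtain U where U: "open U" "\<eta> \<in> U" "bounded (\<Union>\<zeta>\<in>U. T \<zeta>)"
      using lb unfolding locally_bounded_map_def by blast
    have "eventually (\<lambda>k. p k \<in> U) sequentially"
      using limp U topological_tendstoD by blast
    then obtain K where K: "\<And>k. k \<ge> K \<Longrightarrow> p k \<in> U"
      by (auto simp: eventually_sequentially)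
    \<comment> \<open>The shift by \<open>K\<close> drops the initial terms that may lie outside
      \<open>U\<close>, so the whole range is bounded.\<close>
    have "bounded (range (\<lambda>k. v (k + K)))"
      by (rule bounded_subset[OF U(3)]) (use v K in fastforce)
    then obtain a s where s: "strict_mono (s :: nat \<Rightarrow> nat)" and a: "((\<lambda>k. v (k + K)) \<circ> s) \<longlonglongrightarrow> a"
      using bounded_imp_convergent_subsequence by blast
    have "((\<lambda>k. p (k + K)) \<circ> s) \<longlonglongrightarrow> \<eta>"
      by (rule LIMSEQ_subseq_LIMSEQ[OF LIMSEQ_ignore_initial_segment[OF limp] s])
    then have aT: "a \<in> T \<eta>"
      by (rule maximal_H_monotone_closed_graph[OF assms(1) dom _ _ a]) (simp add: v)
    have "eventually (\<lambda>k. dist (((\<lambda>k. v (k + K)) \<circ> s) k) a < \<epsilon>) sequentially"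
      using a \<epsilon> by (rule tendstoD)
    then obtain k where "dist (v (s k + K)) a < \<epsilon>"
      by (auto simp: eventually_sequentially)
    then have "v (s k + K) - a \<in> ball 0 \<epsilon>"
      by (simp add: dist_norm norm_minus_commute)
    then have "a + (v (s k + K) - a) \<in> T \<eta> + ball 0 \<epsilon>"
      using aT by (rule set_plus_intro[rotated])
    then show False using far by simp
  qed
qed

end
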